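(* Let $CC$ be a C-system and let $\Pi:\mathcal{O}b_2\to\mathcal{O}b_1$ be a morphism of presheaves on $CC$. There is a bijection $All\lambda_1^{\Pi}\to All\lambda_2^{\Pi}$. Explicitly, the assignment sending $\lambda\in All\lambda_1^{\Pi}$ to the double family $\lambda_{\Gamma,B}$ given by $\lambda_{\Gamma,B}(o)=\lambda_{\Gamma}(o)$ for $\Gamma\in Ob$, $B\in\mathcal{O}b_2(\Gamma)$, $o\in\partial^{-1}(B)$ is a well-defined bijection, with inverse sending $\lambda_{*,*}$ to the morphism of presheaves with components $o\mapsto\lambda_{\Gamma,\partial(o)}(o)$.
   Context: Composition is written in diagrammatic order: for $f:X\to Y$, $g:Y\to Z$, the composite is $f\circ g:X\to Z$. A C-system $CC$ consists of a category with set of objects $Ob$ and set of morphisms $Mor$, functions $l:Ob\to\mathbb{N}$ and $ft:Ob\to Ob$, an object $pt$, for each $X$ a morphism $p_X:X\to ft(X)$, and for each $X$ with $l(X)>0$ and each $f:Y\to ft(X)$ an object $f^*(X)$ and a morphism $q(f,X):f^*(X)\to X$, such that: $l^{-1}(0)=\{pt\}$; $l(ft(X))=l(X)-1$ if $l(X)>0$; $ft(pt)=pt$; $pt$ is a final object; if $l(X)>0$ and $f:Y\to ft(X)$, then $l(f^*(X))>0$, $ft(f^*(X))=Y$, $p_{f^*(X)}\circ f=q(f,X)\circ p_X$ and this square is a pullback; $Id_{ft(X)}^*(X)=X$ and $q(Id_{ft(X)},X)=Id_X$; for $g:Z\to Y$ and $f:Y\to ft(X)$, $(g\circ f)^*(X)=g^*(f^*(X))$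 and $q(g\circ f,X)=q(g,f^*(X))\circ q(f,X)$. $X\ge Y$ ("$X$ is over $Y$") means $l(X)\ge l(Y)$ and $Y=ft^{l(X)-l(Y)}(X)$; $X>Y$ means $X\ge Y$ and $l(X)>l(Y)$. For $X\ge Y$, $p(X,Y):X\to Y$ is defined by $p(X,X)=Id_X$, $p(X,Y)=p_X\circ p(ft(X),Y)$ if $X>Y$. For $X\ge\Gamma$ and $f:\Gamma'\to\Gamma$, $f^*(X)$ and $q(f,X):f^*(X)\to X$ are defined recursively by $f^*(\Gamma)=\Gamma'$, $q(f,\Gamma)=f$, and, for $X>\Gamma$, $f^*(X)=q(f,ft(X))^*(X)$, $q(f,X)=q(q(f,ft(X)),X)$. A morphism $a:X\to Y$ is a morphism over $\Gamma$ if $X,Y\ge\Gamma$ and $a\circ p(Y,\Gamma)=p(X,\Gamma)$; for such $a$ and $f:\Gamma'\to\Gamma$, $f^*(a):f^*(X)\to f^*(Y)$ is the unique morphism over $\Gamma'$ with $f^*(a)\circ q(f,Y)=q(f,X)\circ a$. For $p:X\to Y$, $sec(p)=\{s:Y\to X\mid s\circ p=Id_Y\}$. Presheaves: $\mathcal{O}b_n(\Gamma)=\{X\mid l(X)=l(\Gamma)+n,\ ft^n(X)=\Gamma\}$ and $\widetilde{\mathcal{O}b}_n(\Gamma)=\{o\in Mor\mid codom(o)\in\mathcal{O}b_n(\Gamma),\ o\in sec(p_{codom(o)}),\ codom(o)>\Gamma\}$, each with restriction along $f:\Gamma'\to\Gamma$ given by $f^*$; $\partial:\widetilde{\mathcal{O}b}_n\to\mathcal{O}b_n$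 is $\partial(o)=codom(o)$. $All\lambda_1^{\Pi}$ is the set of morphisms of presheaves $\lambda:\widetilde{\mathcal{O}b}_2\to\widetilde{\mathcal{O}b}_1$ such that the square formed by $\lambda$, $\Pi$ and the two morphisms $\partial$ (so $\lambda\circ\partial=\partial\circ\Pi$) commutes and is a pullback. $All\lambda_2^{\Pi}$ is the set of double families of bijections $\lambda_{\Gamma,B}:\partial^{-1}(B)\to\partial^{-1}(\Pi_{\Gamma}(B))$, parametrized by $\Gamma\in Ob$ and $B\in\mathcal{O}b_2(\Gamma)$, such that for every $f:\Gamma'\to\Gamma$, $B\in\mathcal{O}b_2(\Gamma)$ and $o\in\partial^{-1}(B)$ one has $f^*(\lambda_{\Gamma,B}(o))=\lambda_{\Gamma',f^*(B)}(f^*(o))$. Here $\partial^{-1}(B)\subset\widetilde{\mathcal{O}b}_2(\Gamma)$ and $\partial^{-1}(\Pi_\Gamma(B))\subset\widetilde{\mathcal{O}b}_1(\Gamma)$ are the fibers of $\partial$. *)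

theory Defs
  imports "HOL-Library.FuncSet"
begin

section \<open>C-systems\<close>

text \<open>
  Composition is in diagrammatic order: \<open>f \<cdot> g\<close> is first \<open>f\<close>, then \<open>g\<close>.
  The field \<open>pb CC f X\<close> is the object \<open>f\<^sup>*(X)\<close> and \<open>qm CC f X\<close> the morphism
  \<open>q(f, X)\<close>; both are constrained only when \<open>len CC X > 0\<close> and \<open>tgt CC f = ft CC X\<close>.
\<close>

record ('o, 'm) csys =
  Ob   :: "'o set"
  Mor  :: "'m set"
  src  :: "'m \<Rightarrow> 'o"
  tgt  :: "'m \<Rightarrow> 'o"
  Idm  :: "'o \<Rightarrow> 'm"
  cmp  :: "'m \<Rightarrow> 'm \<Rightarrow> 'm"  (infixl "\<cdot>\<index>" 70)
  len  :: "'o \<Rightarrow> nat"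
  ft   :: "'o \<Rightarrow> 'o"
  pt   :: "'o"
  proj :: "'o \<Rightarrow> 'm"
  pb   :: "'m \<Rightarrow> 'o \<Rightarrow> 'o"
  qm   :: "'m \<Rightarrow> 'o \<Rightarrow> 'm"

definition Hom :: "('o, 'm) csys \<Rightarrow> 'o \<Rightarrow> 'o \<Rightarrow> 'm set" where
  "Hom CC X Y = {f \<in> Mor CC. src CC f = X \<and> tgt CC f = Y}"

locale csys_category =
  fixes CC :: "('o, 'm) csys" (structure)
  assumes src_Ob: "f \<in> Mor CC \<Longrightarrow> src CC f \<in> Ob CC"
    and tgt_Ob: "f \<in> Mor CC \<Longrightarrow> tgt CC f \<in> Ob CC"
    and Id_Hom: "X \<in> Ob CC \<Longrightarrow> Idm CC X \<in> Hom CC X X"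
    and cmp_Hom: "f \<in> Hom CC X Y \<Longrightarrow> g \<in> Hom CC Y Z \<Longrightarrow> f \<cdot> g \<in> Hom CC X Z"
    and Id_cmp: "f \<in> Hom CC X Y \<Longrightarrow> Idm CC X \<cdot> f = f"
    and cmp_Id: "f \<in> Hom CC X Y \<Longrightarrow> f \<cdot> Idm CC Y = f"
    and cmp_assoc: "f \<in> Hom CC W X \<Longrightarrow> g \<in> Hom CC X Y \<Longrightarrow> h \<in> Hom CC Y Z \<Longrightarrow>
          (f \<cdot> g) \<cdot> h = f \<cdot> (g \<cdot> h)"

text \<open>
  \<open>is_pullback CC h k f g\<close>: the square \<open>h \<cdot> f = k \<cdot> g\<close>, with
  \<open>h : P \<rightarrow> A\<close>, \<open>k : P \<rightarrow> B\<close>, \<open>f : A \<rightarrow> C\<close>, \<open>g : B \<rightarrow> C\<close>, is a pullback.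
\<close>

definition is_pullback :: "('o, 'm) csys \<Rightarrow> 'm \<Rightarrow> 'm \<Rightarrow> 'm \<Rightarrow> 'm \<Rightarrow> bool" where
  "is_pullback CC h k f g \<longleftrightarrow>
     (\<exists>P A B C. h \<in> Hom CC P A \<and> k \<in> Hom CC P B \<and> f \<in> Hom CC A C \<and> g \<in> Hom CC B C \<and>
        h \<cdot>\<^bsub>CC\<^esub> f = k \<cdot>\<^bsub>CC\<^esub> g \<and>
        (\<forall>W \<in> Ob CC. \<forall>a \<in> Hom CC W A. \<forall>b \<in> Hom CC W B. a \<cdot>\<^bsub>CC\<^esub> f = b \<cdot>\<^bsub>CC\<^esub> g \<longrightarrow>
           (\<exists>!u. u \<in> Hom CC W P \<and> u \<cdot>\<^bsub>CC\<^esub> h = a \<and> u \<cdot>\<^bsub>CC\<^esub> k = b)))"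

locale c_system = csys_category +
  assumes ft_Ob: "X \<in> Ob CC \<Longrightarrow> ft CC X \<in> Ob CC"
    and proj_Hom: "X \<in> Ob CC \<Longrightarrow> proj CC X \<in> Hom CC X (ft CC X)"
    and pb_Ob: "X \<in> Ob CC \<Longrightarrow> len CC X > 0 \<Longrightarrow> f \<in> Hom CC Y (ft CC X) \<Longrightarrow> pb CC f X \<in> Ob CC"
    and q_Hom: "X \<in> Ob CC \<Longrightarrow> len CC X > 0 \<Longrightarrow> f \<in> Hom CC Y (ft CC X) \<Longrightarrow>
          qm CC f X \<in> Hom CC (pb CC f X) X"
    and len_0: "{X \<in> Ob CC. len CC X = 0} = {pt CC}"
    and len_ft: "X \<in> Ob CC \<Longrightarrow> len CC X > 0 \<Longrightarrow> len CC (ft CC X) = len CC X - 1"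
    and ft_pt: "ft CC (pt CC) = pt CC"
    and pt_final: "X \<in> Ob CC \<Longrightarrow> \<exists>!f. f \<in> Hom CC X (pt CC)"
    and len_pb: "X \<in> Ob CC \<Longrightarrow> len CC X > 0 \<Longrightarrow> f \<in> Hom CC Y (ft CC X) \<Longrightarrow>
          len CC (pb CC f X) > 0"
    and ft_pb: "X \<in> Ob CC \<Longrightarrow> len CC X > 0 \<Longrightarrow> f \<in> Hom CC Y (ft CC X) \<Longrightarrow>
          ft CC (pb CC f X) = Y"
    and pb_square: "X \<in> Ob CC \<Longrightarrow> len CC X > 0 \<Longrightarrow> f \<in> Hom CC Y (ft CC X) \<Longrightarrow>
          is_pullback CC (proj CC (pb CC f X)) (qm CC f X) f (proj CC X)"
    and pb_Id: "X \<in> Ob CC \<Longrightarrow> len CC X > 0 \<Longrightarrow> pb CC (Idm CC (ft CC X)) X = X"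
    and q_Id: "X \<in> Ob CC \<Longrightarrow> len CC X > 0 \<Longrightarrow> qm CC (Idm CC (ft CC X)) X = Idm CC X"
    and pb_cmp: "X \<in> Ob CC \<Longrightarrow> len CC X > 0 \<Longrightarrow> g \<in> Hom CC Z Y \<Longrightarrow> f \<in> Hom CC Y (ft CC X) \<Longrightarrow>
          pb CC (g \<cdot> f) X = pb CC g (pb CC f X)"
    and q_cmp: "X \<in> Ob CC \<Longrightarrow> len CC X > 0 \<Longrightarrow> g \<in> Hom CC Z Y \<Longrightarrow> f \<in> Hom CC Y (ft CC X) \<Longrightarrow>
          qm CC (g \<cdot> f) X = qm CC g (pb CC f X) \<cdot> qm CC f X"

section \<open>Objects and morphisms over an object\<close>

definition over :: "('o, 'm) csys \<Rightarrow> 'o \<Rightarrow> 'o \<Rightarrow> bool" where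
  "over CC X Y \<longleftrightarrow> X \<in> Ob CC \<and> Y \<in> Ob CC \<and> len CC X \<ge> len CC Y \<and>
     Y = (ft CC ^^ (len CC X - len CC Y)) X"

definition strictly_over :: "('o, 'm) csys \<Rightarrow> 'o \<Rightarrow> 'o \<Rightarrow> bool" where
  "strictly_over CC X Y \<longleftrightarrow> over CC X Y \<and> len CC X > len CC Y"

text \<open>
  The recursions defining \<open>p(X, \<Gamma>)\<close>, \<open>f\<^sup>*(X)\<close> and \<open>q(f, X)\<close> for \<open>X \<ge> \<Gamma>\<close> descend from
  \<open>X\<close> to \<open>ft X\<close>; the extra argument of \<open>projn\<close>, \<open>pbn\<close> and \<open>qn\<close> is the number
  \<open>len X - len \<Gamma>\<close> of remaining steps.
\<close>

primrec projn :: "nat \<Rightarrow> ('o, 'm) csys \<Rightarrow> 'o \<Rightarrow> 'm" where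
  "projn 0 CC X = Idm CC X"
| "projn (Suc n) CC X = proj CC X \<cdot>\<^bsub>CC\<^esub> projn n CC (ft CC X)"

definition proj_to :: "('o, 'm) csys \<Rightarrow> 'o \<Rightarrow> 'o \<Rightarrow> 'm" where
  "proj_to CC X Y = projn (len CC X - len CC Y) CC X"

primrec qn :: "nat \<Rightarrow> ('o, 'm) csys \<Rightarrow> 'm \<Rightarrow> 'o \<Rightarrow> 'm" where
  "qn 0 CC f X = f"
| "qn (Suc n) CC f X = qm CC (qn n CC f (ft CC X)) X"

primrec pbn :: "nat \<Rightarrow> ('o, 'm) csys \<Rightarrow> 'm \<Rightarrow> 'o \<Rightarrow> 'o" where
  "pbn 0 CC f X = src CC f"
| "pbn (Suc n) CC f X = pb CC (qn n CC f (ft CC X)) X"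

text \<open>In the following, \<open>f : \<Gamma>' \<rightarrow> \<Gamma>\<close> and \<open>X\<close> is over \<open>\<Gamma>\<close>.\<close>

definition pull_ob :: "('o, 'm) csys \<Rightarrow> 'm \<Rightarrow> 'o \<Rightarrow> 'o" where
  "pull_ob CC f X = pbn (len CC X - len CC (tgt CC f)) CC f X"

definition pull_q :: "('o, 'm) csys \<Rightarrow> 'm \<Rightarrow> 'o \<Rightarrow> 'm" where
  "pull_q CC f X = qn (len CC X - len CC (tgt CC f)) CC f X"

definition mor_over :: "('o, 'm) csys \<Rightarrow> 'o \<Rightarrow> 'm \<Rightarrow> bool" where
  "mor_over CC \<Gamma> a \<longleftrightarrow> a \<in> Mor CC \<and> over CC (src CC a) \<Gamma> \<and> over CC (tgt CC a) \<Gamma> \<and>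
     a \<cdot>\<^bsub>CC\<^esub> proj_to CC (tgt CC a) \<Gamma> = proj_to CC (src CC a) \<Gamma>"

definition pull_mor :: "('o, 'm) csys \<Rightarrow> 'm \<Rightarrow> 'm \<Rightarrow> 'm" where
  "pull_mor CC f a = (THE b.
     b \<in> Hom CC (pull_ob CC f (src CC a)) (pull_ob CC f (tgt CC a)) \<and>
     mor_over CC (src CC f) b \<and>
     b \<cdot>\<^bsub>CC\<^esub> pull_q CC f (tgt CC a) = pull_q CC f (src CC a) \<cdot>\<^bsub>CC\<^esub> a)"

definition sec :: "('o, 'm) csys \<Rightarrow> 'm \<Rightarrow> 'm set" where
  "sec CC p = {s \<in> Hom CC (tgt CC p) (src CC p). s \<cdot>\<^bsub>CC\<^esub> p = Idm CC (tgt CC p)}"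

section \<open>Presheaves of sets\<close>

record ('o, 'm, 'x) presheaf =
  val   :: "'o \<Rightarrow> 'x set"
  restr :: "'m \<Rightarrow> 'x \<Rightarrow> 'x"

definition is_presheaf :: "('o, 'm) csys \<Rightarrow> ('o, 'm, 'x) presheaf \<Rightarrow> bool" where
  "is_presheaf CC F \<longleftrightarrow>
     (\<forall>\<Gamma>' \<Gamma> f x. f \<in> Hom CC \<Gamma>' \<Gamma> \<and> x \<in> val F \<Gamma> \<longrightarrow> restr F f x \<in> val F \<Gamma>') \<and>
     (\<forall>\<Gamma> \<in> Ob CC. \<forall>x \<in> val F \<Gamma>. restr F (Idm CC \<Gamma>) x = x) \<and>
     (\<forall>\<Gamma>'' \<Gamma>' \<Gamma> g f x. g \<in> Hom CC \<Gamma>'' \<Gamma>' \<and> f \<in> Hom CC \<Gamma>' \<Gamma> \<and> x \<in> val F \<Gamma> \<longrightarrow>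
        restr F (g \<cdot>\<^bsub>CC\<^esub> f) x = restr F g (restr F f x))"

text \<open>
  A morphism of presheaves is an extensional family of extensional functions, so that
  equality in HOL is equality of morphisms.
\<close>

definition psh_hom ::
  "('o, 'm) csys \<Rightarrow> ('o, 'm, 'x) presheaf \<Rightarrow> ('o, 'm, 'y) presheaf \<Rightarrow> ('o \<Rightarrow> 'x \<Rightarrow> 'y) set" where
  "psh_hom CC F G = {\<phi> \<in> (\<Pi>\<^sub>E \<Gamma> \<in> Ob CC. val F \<Gamma> \<rightarrow>\<^sub>E val G \<Gamma>).
     \<forall>\<Gamma>' \<Gamma> f x. f \<in> Hom CC \<Gamma>' \<Gamma> \<and> x \<in> val F \<Gamma> \<longrightarrow> \<phi> \<Gamma>' (restr F f x) = restr G f (\<phi> \<Gamma> x)}"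

text \<open>Composition, again in diagrammatic order, of \<open>\<phi> : F \<rightarrow> G\<close> and \<open>\<psi> : G \<rightarrow> H\<close>.\<close>

definition psh_comp ::
  "('o, 'm) csys \<Rightarrow> ('o, 'm, 'x) presheaf \<Rightarrow> ('o \<Rightarrow> 'x \<Rightarrow> 'y) \<Rightarrow> ('o \<Rightarrow> 'y \<Rightarrow> 'z) \<Rightarrow> 'o \<Rightarrow> 'x \<Rightarrow> 'z" where
  "psh_comp CC F \<phi> \<psi> = (\<lambda>\<Gamma> \<in> Ob CC. \<lambda>x \<in> val F \<Gamma>. \<psi> \<Gamma> (\<phi> \<Gamma> x))"

text \<open>
  The square \<open>h \<cdot> f = k \<cdot> g\<close> with \<open>h : P \<rightarrow> A\<close>, \<open>k : P \<rightarrow> B\<close>, \<open>f : A \<rightarrow> C\<close>, \<open>g : B \<rightarrow> C\<close>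
  is a pullback in the category of presheaves.  HOL cannot quantify over types inside a
  formula, so the type \<open>'w\<close> in which the test presheaves \<open>W\<close> take their values is a parameter.
  For the universal property to be the intended one, \<open>'w\<close> has to be large enough: with
  \<open>'w = 'm + 'u\<close> and \<open>'u\<close> an arbitrary type, the presheaves valued in \<open>'w\<close> include isomorphic
  copies of \<open>Obn\<close> and \<open>Obtn\<close> below (objects embed into \<open>'m\<close> by \<open>Idm\<close>), of the
  representables, and of all presheaves valued in \<open>'u\<close>.
\<close>

definition psh_pullback ::
  "'w itself \<Rightarrow> ('o, 'm) csys \<Rightarrow>
   ('o, 'm, 'p) presheaf \<Rightarrow> ('o, 'm, 'a) presheaf \<Rightarrow> ('o, 'm, 'b) presheaf \<Rightarrow> ('o, 'm, 'c) presheaf \<Rightarrow>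
   ('o \<Rightarrow> 'p \<Rightarrow> 'a) \<Rightarrow> ('o \<Rightarrow> 'p \<Rightarrow> 'b) \<Rightarrow> ('o \<Rightarrow> 'a \<Rightarrow> 'c) \<Rightarrow> ('o \<Rightarrow> 'b \<Rightarrow> 'c) \<Rightarrow> bool" where
  "psh_pullback (T :: 'w itself) CC P A B C h k f g \<longleftrightarrow>
     is_presheaf CC P \<and> is_presheaf CC A \<and> is_presheaf CC B \<and> is_presheaf CC C \<and>
     h \<in> psh_hom CC P A \<and> k \<in> psh_hom CC P B \<and> f \<in> psh_hom CC A C \<and> g \<in> psh_hom CC B C \<and>
     psh_comp CC P h f = psh_comp CC P k g \<and>
     (\<forall>W :: ('o, 'm, 'w) presheaf. is_presheaf CC W \<longrightarrow>
        (\<forall>a \<in> psh_hom CC W A. \<forall>b \<in> psh_hom CC W B. psh_comp CC W a f = psh_comp CC W b g \<longrightarrow>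
           (\<exists>!u. u \<in> psh_hom CC W P \<and> psh_comp CC W u h = a \<and> psh_comp CC W u k = b)))"

section \<open>The presheaves of types and of terms, and \<open>\<lambda>\<close>-structures\<close>

definition Obn :: "('o, 'm) csys \<Rightarrow> nat \<Rightarrow> ('o, 'm, 'o) presheaf" where
  "Obn CC n = \<lparr>
     val = (\<lambda>\<Gamma>. {X \<in> Ob CC. len CC X = len CC \<Gamma> + n \<and> (ft CC ^^ n) X = \<Gamma>}),
     restr = pull_ob CC\<rparr>"

definition Obtn :: "('o, 'm) csys \<Rightarrow> nat \<Rightarrow> ('o, 'm, 'm) presheaf" where
  "Obtn CC n = \<lparr>
     val = (\<lambda>\<Gamma>. {s \<in> Mor CC. tgt CC s \<in> val (Obn CC n) \<Gamma> \<and> s \<in> sec CC (proj CC (tgt CC s)) \<and>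
              strictly_over CC (tgt CC s) \<Gamma>}),
     restr = pull_mor CC\<rparr>"

definition bd :: "('o, 'm) csys \<Rightarrow> nat \<Rightarrow> 'o \<Rightarrow> 'm \<Rightarrow> 'o" where
  "bd CC n = (\<lambda>\<Gamma> \<in> Ob CC. \<lambda>s \<in> val (Obtn CC n) \<Gamma>. tgt CC s)"

definition bd_fiber :: "('o, 'm) csys \<Rightarrow> nat \<Rightarrow> 'o \<Rightarrow> 'o \<Rightarrow> 'm set" where
  "bd_fiber CC n \<Gamma> B = {s \<in> val (Obtn CC n) \<Gamma>. bd CC n \<Gamma> s = B}"

definition All_lambda1 ::
  "'w itself \<Rightarrow> ('o, 'm) csys \<Rightarrow> ('o \<Rightarrow> 'o \<Rightarrow> 'o) \<Rightarrow> ('o \<Rightarrow> 'm \<Rightarrow> 'm) set" where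
  "All_lambda1 T CC PiS = {lam \<in> psh_hom CC (Obtn CC 2) (Obtn CC 1).
     psh_pullback T CC (Obtn CC 2) (Obtn CC 1) (Obn CC 2) (Obn CC 1) lam (bd CC 2) (bd CC 1) PiS}"

definition All_lambda2 ::
  "('o, 'm) csys \<Rightarrow> ('o \<Rightarrow> 'o \<Rightarrow> 'o) \<Rightarrow> ('o \<Rightarrow> 'o \<Rightarrow> 'm \<Rightarrow> 'm) set" where
  "All_lambda2 CC PiS =
     {fam \<in> (\<Pi>\<^sub>E \<Gamma> \<in> Ob CC. \<Pi>\<^sub>E B \<in> val (Obn CC 2) \<Gamma>.
              bd_fiber CC 2 \<Gamma> B \<rightarrow>\<^sub>E bd_fiber CC 1 \<Gamma> (PiS \<Gamma> B)).
        (\<forall>\<Gamma> \<in> Ob CC. \<forall>B \<in> val (Obn CC 2) \<Gamma>.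
           bij_betw (fam \<Gamma> B) (bd_fiber CC 2 \<Gamma> B) (bd_fiber CC 1 \<Gamma> (PiS \<Gamma> B))) \<and>
        (\<forall>\<Gamma>' \<Gamma> f. f \<in> Hom CC \<Gamma>' \<Gamma> \<longrightarrow>
           (\<forall>B \<in> val (Obn CC 2) \<Gamma>. \<forall>s \<in> bd_fiber CC 2 \<Gamma> B.
              restr (Obtn CC 1) f (fam \<Gamma> B s) =
              fam \<Gamma>' (restr (Obn CC 2) f B) (restr (Obtn CC 2) f s)))}"

definition lambda_1_to_2 :: "('o, 'm) csys \<Rightarrow> ('o \<Rightarrow> 'm \<Rightarrow> 'm) \<Rightarrow> 'o \<Rightarrow> 'o \<Rightarrow> 'm \<Rightarrow> 'm" where
  "lambda_1_to_2 CC lam =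
     (\<lambda>\<Gamma> \<in> Ob CC. \<lambda>B \<in> val (Obn CC 2) \<Gamma>. \<lambda>s \<in> bd_fiber CC 2 \<Gamma> B. lam \<Gamma> s)"

definition lambda_2_to_1 :: "('o, 'm) csys \<Rightarrow> ('o \<Rightarrow> 'o \<Rightarrow> 'm \<Rightarrow> 'm) \<Rightarrow> 'o \<Rightarrow> 'm \<Rightarrow> 'm" where
  "lambda_2_to_1 CC fam =
     (\<lambda>\<Gamma> \<in> Ob CC. \<lambda>s \<in> val (Obtn CC 2) \<Gamma>. fam \<Gamma> (bd CC 2 \<Gamma> s) s)"

end

theory Submission
  imports Defs
begin

text \<open>
  The theorem rests on one general fact: limits of presheaves are computed pointwise.  A square of
  presheaves is a pullback if and only if, for each \<open>\<Gamma>\<close>, its component at \<open>\<Gamma>\<close> is a pullback of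
  sets (\<open>psh_pullback_iff_pointwise\<close>).  One direction glues the pointwise solutions, which are
  natural because they are unique; the other tests the universal property on the presheaf
  represented by \<open>\<Gamma>\<close> and reads off the value at the identity, as in the Yoneda lemma.

  For the square formed by \<open>\<lambda>\<close>, \<open>\<Pi>\<close> and the two morphisms \<open>\<partial>\<close>, the component at \<open>\<Gamma>\<close> is a pullback
  of sets exactly when \<open>\<lambda>\<^sub>\<Gamma>\<close> maps the fiber of \<open>\<partial>\<close> over each \<open>B\<close> bijectively to the fiber over
  \<open>\<Pi>\<^sub>\<Gamma>(B)\<close>.  Hence a pullback structure is the same thing as a natural family of bijections between
  fibers, and the two translations only regroup one function on \<open>Obtn 2\<close> as a family of functions on
  the fibers that partition it.

  What has to be established about C-systems is that \<open>Obn\<close> and \<open>Obtn\<close> are presheaves and that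
  \<open>\<partial>\<close> is natural.  The substance lies in the restriction of terms: \<open>f\<^sup>*(s)\<close> is defined as a
  unique morphism over \<open>\<Gamma>'\<close>, and it is first identified with the section of the pulled back
  projection induced by the canonical square (\<open>pull_mor_eq_iff\<close>).  In that form
  functoriality follows from uniqueness.
\<close>

section \<open>Pullbacks of presheaves are computed pointwise\<close>

lemma psh_homI:
  assumes "\<And>\<Gamma>. \<Gamma> \<in> Ob CC \<Longrightarrow> \<phi> \<Gamma> \<in> val F \<Gamma> \<rightarrow>\<^sub>E val G \<Gamma>"
    and "\<And>\<Gamma>. \<Gamma> \<notin> Ob CC \<Longrightarrow> \<phi> \<Gamma> = undefined"
    and "\<And>\<Gamma>' \<Gamma> f x. f \<in> Hom CC \<Gamma>' \<Gamma> \<Longrightarrow> x \<in> val F \<Gamma> \<Longrightarrow> \<phi> \<Gamma>' (restr F f x) = restr G f (\<phi> \<Gamma> x)"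
  shows "\<phi> \<in> psh_hom CC F G"
  unfolding psh_hom_def using assms by (auto simp: PiE_iff extensional_def)

lemma psh_hom_val:
  "\<phi> \<in> psh_hom CC F G \<Longrightarrow> \<Gamma> \<in> Ob CC \<Longrightarrow> x \<in> val F \<Gamma> \<Longrightarrow> \<phi> \<Gamma> x \<in> val G \<Gamma>"
  unfolding psh_hom_def by (auto simp: PiE_iff)

lemma psh_hom_natural:
  "\<phi> \<in> psh_hom CC F G \<Longrightarrow> f \<in> Hom CC \<Gamma>' \<Gamma> \<Longrightarrow> x \<in> val F \<Gamma> \<Longrightarrow>
     \<phi> \<Gamma>' (restr F f x) = restr G f (\<phi> \<Gamma> x)"
  unfolding psh_hom_def by blast

lemma psh_hom_undefined:
  assumes "\<phi> \<in> psh_hom CC F G"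
  shows "\<Gamma> \<notin> Ob CC \<Longrightarrow> \<phi> \<Gamma> = undefined"
    and "\<Gamma> \<in> Ob CC \<Longrightarrow> x \<notin> val F \<Gamma> \<Longrightarrow> \<phi> \<Gamma> x = undefined"
  using assms unfolding psh_hom_def by (auto simp: PiE_iff extensional_def)

lemma psh_hom_eqI:
  assumes "\<phi> \<in> psh_hom CC F G" "\<psi> \<in> psh_hom CC F H"
    and "\<And>\<Gamma> x. \<Gamma> \<in> Ob CC \<Longrightarrow> x \<in> val F \<Gamma> \<Longrightarrow> \<phi> \<Gamma> x = \<psi> \<Gamma> x"
  shows "\<phi> = \<psi>"
proof (intro ext)
  fix \<Gamma> x
  show "\<phi> \<Gamma> x = \<psi> \<Gamma> x"
    using assms(3) psh_hom_undefined[OF assms(1)] psh_hom_undefined[OF assms(2)]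
    by (cases "\<Gamma> \<in> Ob CC"; cases "x \<in> val F \<Gamma>") auto
qed

lemma psh_comp_apply:
  "\<Gamma> \<in> Ob CC \<Longrightarrow> x \<in> val F \<Gamma> \<Longrightarrow> psh_comp CC F \<phi> \<psi> \<Gamma> x = \<psi> \<Gamma> (\<phi> \<Gamma> x)"
  unfolding psh_comp_def by simp

lemma psh_comp_eq_iff:
  "psh_comp CC F \<phi> \<psi> = psh_comp CC F \<phi>' \<psi>' \<longleftrightarrow>
     (\<forall>\<Gamma> \<in> Ob CC. \<forall>x \<in> val F \<Gamma>. \<psi> \<Gamma> (\<phi> \<Gamma> x) = \<psi>' \<Gamma> (\<phi>' \<Gamma> x))"
  unfolding psh_comp_def by (auto simp: fun_eq_iff restrict_def)

lemma psh_comp_eqI: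
  assumes "a \<in> psh_hom CC F G"
    and "\<And>\<Gamma> x. \<Gamma> \<in> Ob CC \<Longrightarrow> x \<in> val F \<Gamma> \<Longrightarrow> \<psi> \<Gamma> (\<phi> \<Gamma> x) = a \<Gamma> x"
  shows "psh_comp CC F \<phi> \<psi> = a"
  unfolding psh_comp_def using assms psh_hom_undefined[OF assms(1)]
  by (auto simp: fun_eq_iff restrict_def)

lemma presheaf_restr_val:
  "is_presheaf CC F \<Longrightarrow> f \<in> Hom CC \<Gamma>' \<Gamma> \<Longrightarrow> x \<in> val F \<Gamma> \<Longrightarrow> restr F f x \<in> val F \<Gamma>'"
  unfolding is_presheaf_def by blast

lemma presheaf_restr_Id:
  "is_presheaf CC F \<Longrightarrow> \<Gamma> \<in> Ob CC \<Longrightarrow> x \<in> val F \<Gamma> \<Longrightarrow> restr F (Idm CC \<Gamma>) x = x"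
  unfolding is_presheaf_def by blast

lemma presheaf_restr_cmp:
  "is_presheaf CC F \<Longrightarrow> g \<in> Hom CC \<Gamma>'' \<Gamma>' \<Longrightarrow> f \<in> Hom CC \<Gamma>' \<Gamma> \<Longrightarrow> x \<in> val F \<Gamma> \<Longrightarrow>
     restr F (g \<cdot>\<^bsub>CC\<^esub> f) x = restr F g (restr F f x)"
  unfolding is_presheaf_def by blast

text \<open>
  The representable presheaf, tagged by \<open>Inl\<close> so that it lives in the type of test values that
  occurs in the theorem.
\<close>

definition yoneda :: "('o, 'm) csys \<Rightarrow> 'o \<Rightarrow> ('o, 'm, 'm + 'u) presheaf" where
  "yoneda CC \<Gamma> = \<lparr>
     val = (\<lambda>\<Delta>. Inl ` Hom CC \<Delta> \<Gamma>),
     restr = (\<lambda>g x. Inl (g \<cdot>\<^bsub>CC\<^esub> projl x))\<rparr>"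

definition yoneda_map ::
  "('o, 'm) csys \<Rightarrow> 'o \<Rightarrow> ('o, 'm, 'x) presheaf \<Rightarrow> 'x \<Rightarrow> 'o \<Rightarrow> 'm + 'u \<Rightarrow> 'x" where
  "yoneda_map CC \<Gamma> F x =
     (\<lambda>\<Delta> \<in> Ob CC. \<lambda>w \<in> val (yoneda CC \<Gamma> :: ('o, 'm, 'm + 'u) presheaf) \<Delta>. restr F (projl w) x)"

definition pointwise_pullback ::
  "('o, 'm) csys \<Rightarrow>
   ('o, 'm, 'p) presheaf \<Rightarrow> ('o, 'm, 'a) presheaf \<Rightarrow> ('o, 'm, 'b) presheaf \<Rightarrow>
   ('o \<Rightarrow> 'p \<Rightarrow> 'a) \<Rightarrow> ('o \<Rightarrow> 'p \<Rightarrow> 'b) \<Rightarrow> ('o \<Rightarrow> 'a \<Rightarrow> 'c) \<Rightarrow> ('o \<Rightarrow> 'b \<Rightarrow> 'c) \<Rightarrow> bool" where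
  "pointwise_pullback CC P A B h k f g \<longleftrightarrow>
     (\<forall>\<Gamma> \<in> Ob CC. (\<forall>z \<in> val P \<Gamma>. f \<Gamma> (h \<Gamma> z) = g \<Gamma> (k \<Gamma> z)) \<and>
        (\<forall>x \<in> val A \<Gamma>. \<forall>y \<in> val B \<Gamma>. f \<Gamma> x = g \<Gamma> y \<longrightarrow>
           (\<exists>!z. z \<in> val P \<Gamma> \<and> h \<Gamma> z = x \<and> k \<Gamma> z = y)))"

context csys_category
begin

lemma Hom_Ob:
  assumes "f \<in> Hom CC X Y"
  shows "X \<in> Ob CC" "Y \<in> Ob CC"
  using assms src_Ob tgt_Ob unfolding Hom_def by auto

lemma is_presheaf_yoneda: "is_presheaf CC (yoneda CC \<Gamma>)"
  unfolding is_presheaf_def yoneda_def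
  by (auto intro: cmp_Hom simp: Id_cmp cmp_assoc)

lemma yoneda_map_psh_hom:
  assumes F: "is_presheaf CC F" and x: "x \<in> val F \<Gamma>"
  shows "yoneda_map CC \<Gamma> F x \<in> psh_hom CC (yoneda CC \<Gamma>) F"
proof (rule psh_homI)
  fix \<Delta> assume "\<Delta> \<in> Ob CC"
  then show "yoneda_map CC \<Gamma> F x \<Delta> \<in> val (yoneda CC \<Gamma>) \<Delta> \<rightarrow>\<^sub>E val F \<Delta>"
    using presheaf_restr_val[OF F _ x] by (auto simp: yoneda_map_def yoneda_def)
next
  fix \<Delta> assume "\<Delta> \<notin> Ob CC"
  then show "yoneda_map CC \<Gamma> F x \<Delta> = undefined" by (simp add: yoneda_map_def)
next
  fix \<Delta>' \<Delta> g w
  assume g: "g \<in> Hom CC \<Delta>' \<Delta>" and "w \<in> val (yoneda CC \<Gamma>) \<Delta>"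
  then obtain e where e: "w = Inl e" "e \<in> Hom CC \<Delta> \<Gamma>" by (auto simp: yoneda_def)
  then show "yoneda_map CC \<Gamma> F x \<Delta>' (restr (yoneda CC \<Gamma>) g w) =
      restr F g (yoneda_map CC \<Gamma> F x \<Delta> w)"
    using Hom_Ob[OF g] cmp_Hom[OF g e(2)] presheaf_restr_cmp[OF F g e(2) x]
    by (auto simp: yoneda_map_def yoneda_def)
qed

lemma yoneda_map_Id:
  assumes F: "is_presheaf CC F" and x: "x \<in> val F \<Gamma>" and \<Gamma>: "\<Gamma> \<in> Ob CC"
  shows "yoneda_map CC \<Gamma> F x \<Gamma> (Inl (Idm CC \<Gamma>)) = x"
  using presheaf_restr_Id[OF F \<Gamma> x] \<Gamma> Id_Hom[OF \<Gamma>] by (auto simp: yoneda_map_def yoneda_def)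

lemma psh_comp_yoneda_map:
  assumes h: "h \<in> psh_hom CC P A" and z: "z \<in> val P \<Gamma>" and A: "is_presheaf CC A"
    and \<Gamma>: "\<Gamma> \<in> Ob CC"
  shows "psh_comp CC (yoneda CC \<Gamma>) (yoneda_map CC \<Gamma> P z) h = yoneda_map CC \<Gamma> A (h \<Gamma> z)"
proof (rule psh_comp_eqI[OF yoneda_map_psh_hom[OF A psh_hom_val[OF h \<Gamma> z]]])
  fix \<Delta> w
  assume "\<Delta> \<in> Ob CC" "w \<in> val (yoneda CC \<Gamma>) \<Delta>"
  then show "h \<Delta> (yoneda_map CC \<Gamma> P z \<Delta> w) = yoneda_map CC \<Gamma> A (h \<Gamma> z) \<Delta> w"
    using psh_hom_natural[OF h _ z] by (auto simp: yoneda_map_def yoneda_def)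
qed

lemma pointwise_pullback_if_psh_pullback:
  assumes pb: "psh_pullback TYPE('m + 'u) CC P A B C h k f g"
  shows "pointwise_pullback CC P A B h k f g"
proof -
  have P: "is_presheaf CC P" and A: "is_presheaf CC A" and B: "is_presheaf CC B"
    and C: "is_presheaf CC C"
    and h: "h \<in> psh_hom CC P A" and k: "k \<in> psh_hom CC P B"
    and f: "f \<in> psh_hom CC A C" and g: "g \<in> psh_hom CC B C"
    and comm: "psh_comp CC P h f = psh_comp CC P k g"
    and univ: "\<And>(W :: ('o, 'm, 'm + 'u) presheaf) a b. is_presheaf CC W \<Longrightarrow>
        a \<in> psh_hom CC W A \<Longrightarrow> b \<in> psh_hom CC W B \<Longrightarrow> psh_comp CC W a f = psh_comp CC W b g \<Longrightarrow>
        \<exists>!u. u \<in> psh_hom CC W P \<and> psh_comp CC W u h = a \<and> psh_comp CC W u k = b"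
    using pb unfolding psh_pullback_def by auto
  have "\<exists>!z. z \<in> val P \<Gamma> \<and> h \<Gamma> z = x \<and> k \<Gamma> z = y"
    if \<Gamma>: "\<Gamma> \<in> Ob CC" and x: "x \<in> val A \<Gamma>" and y: "y \<in> val B \<Gamma>" and eq: "f \<Gamma> x = g \<Gamma> y" for \<Gamma> x y
  proof -
    let ?W = "yoneda CC \<Gamma> :: ('o, 'm, 'm + 'u) presheaf"
    let ?i = "Inl (Idm CC \<Gamma>) :: 'm + 'u"
    have i: "?i \<in> val ?W \<Gamma>" using Id_Hom[OF \<Gamma>] by (simp add: yoneda_def)
    have "psh_comp CC ?W (yoneda_map CC \<Gamma> A x) f = psh_comp CC ?W (yoneda_map CC \<Gamma> B y) g"
      by (simp add: psh_comp_yoneda_map[OF f x C \<Gamma>] psh_comp_yoneda_map[OF g y C \<Gamma>] eq)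
    then have ex1: "\<exists>!u. u \<in> psh_hom CC ?W P \<and> psh_comp CC ?W u h = yoneda_map CC \<Gamma> A x \<and>
        psh_comp CC ?W u k = yoneda_map CC \<Gamma> B y"
      by (rule univ[OF is_presheaf_yoneda yoneda_map_psh_hom[OF A x] yoneda_map_psh_hom[OF B y]])
    then obtain u where u: "u \<in> psh_hom CC ?W P" "psh_comp CC ?W u h = yoneda_map CC \<Gamma> A x"
      "psh_comp CC ?W u k = yoneda_map CC \<Gamma> B y" by blast
    show ?thesis
    proof (rule ex1I[of _ "u \<Gamma> ?i"])
      show "u \<Gamma> ?i \<in> val P \<Gamma> \<and> h \<Gamma> (u \<Gamma> ?i) = x \<and> k \<Gamma> (u \<Gamma> ?i) = y"
        using psh_hom_val[OF u(1) \<Gamma> i] u(2,3) psh_comp_apply[where F = ?W, OF \<Gamma> i]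
          yoneda_map_Id[OF A x \<Gamma>] yoneda_map_Id[OF B y \<Gamma>] by metis
    next
      fix z assume z: "z \<in> val P \<Gamma> \<and> h \<Gamma> z = x \<and> k \<Gamma> z = y"
      have "yoneda_map CC \<Gamma> P z = u"
        using ex1 u z yoneda_map_psh_hom[OF P, of z] psh_comp_yoneda_map[OF h _ A \<Gamma>, of z]
          psh_comp_yoneda_map[OF k _ B \<Gamma>, of z] by blast
      then show "z = u \<Gamma> ?i" using yoneda_map_Id[OF P conjunct1[OF z] \<Gamma>] by metis
    qed
  qed
  then show ?thesis using comm unfolding pointwise_pullback_def psh_comp_eq_iff by auto
qed

lemma psh_pullback_if_pointwise_pullback:
  assumes P: "is_presheaf CC P" and A: "is_presheaf CC A" and B: "is_presheaf CC B"
    and C: "is_presheaf CC C"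
    and h: "h \<in> psh_hom CC P A" and k: "k \<in> psh_hom CC P B"
    and f: "f \<in> psh_hom CC A C" and g: "g \<in> psh_hom CC B C"
    and pw: "pointwise_pullback CC P A B h k f g"
  shows "psh_pullback (T :: 'w itself) CC P A B C h k f g"
proof -
  have "\<exists>!u. u \<in> psh_hom CC W P \<and> psh_comp CC W u h = a \<and> psh_comp CC W u k = b"
    if W: "is_presheaf CC W" and a: "a \<in> psh_hom CC W A" and b: "b \<in> psh_hom CC W B"
      and ab: "psh_comp CC W a f = psh_comp CC W b g"
    for W :: "('o, 'm, 'w) presheaf" and a b
  proof -
    have pw1: "\<exists>!z. z \<in> val P \<Gamma> \<and> h \<Gamma> z = a \<Gamma> w \<and> k \<Gamma> z = b \<Gamma> w"
      if "\<Gamma> \<in> Ob CC" "w \<in> val W \<Gamma>" for \<Gamma> w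
      using pw psh_hom_val[OF a that] psh_hom_val[OF b that] ab that
      unfolding pointwise_pullback_def psh_comp_eq_iff by blast
    define u where "u = (\<lambda>\<Gamma> \<in> Ob CC. \<lambda>w \<in> val W \<Gamma>.
        THE z. z \<in> val P \<Gamma> \<and> h \<Gamma> z = a \<Gamma> w \<and> k \<Gamma> z = b \<Gamma> w)"
    have u: "u \<Gamma> w \<in> val P \<Gamma>" "h \<Gamma> (u \<Gamma> w) = a \<Gamma> w" "k \<Gamma> (u \<Gamma> w) = b \<Gamma> w"
      if "\<Gamma> \<in> Ob CC" "w \<in> val W \<Gamma>" for \<Gamma> w
      using theI'[OF pw1[OF that]] that by (auto simp: u_def)
    have uniq: "z = u \<Gamma> w"
      if "\<Gamma> \<in> Ob CC" "w \<in> val W \<Gamma>" "z \<in> val P \<Gamma>" "h \<Gamma> z = a \<Gamma> w" "k \<Gamma> z = b \<Gamma> w" for \<Gamma> w z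
      using pw1[OF that(1,2)] u[OF that(1,2)] that(3-5) by blast
    \<comment> \<open>Naturality: the restriction of a solution solves the restricted problem, which has only one.\<close>
    have u_hom: "u \<in> psh_hom CC W P"
    proof (rule psh_homI)
      fix \<Gamma> assume "\<Gamma> \<in> Ob CC"
      then show "u \<Gamma> \<in> val W \<Gamma> \<rightarrow>\<^sub>E val P \<Gamma>" using u(1) by (auto simp: u_def)
    next
      fix \<Gamma> assume "\<Gamma> \<notin> Ob CC"
      then show "u \<Gamma> = undefined" by (simp add: u_def)
    next
      fix \<Gamma>' \<Gamma> e w
      assume e: "e \<in> Hom CC \<Gamma>' \<Gamma>" and w: "w \<in> val W \<Gamma>"
      note uw = u[OF Hom_Ob(2)[OF e] w]
      have "restr P e (u \<Gamma> w) = u \<Gamma>' (restr W e w)"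
      proof (rule uniq)
        show "h \<Gamma>' (restr P e (u \<Gamma> w)) = a \<Gamma>' (restr W e w)"
          using psh_hom_natural[OF h e uw(1)] psh_hom_natural[OF a e w] uw(2) by simp
        show "k \<Gamma>' (restr P e (u \<Gamma> w)) = b \<Gamma>' (restr W e w)"
          using psh_hom_natural[OF k e uw(1)] psh_hom_natural[OF b e w] uw(3) by simp
      qed (use Hom_Ob[OF e] presheaf_restr_val[OF W e w] presheaf_restr_val[OF P e uw(1)] in auto)
      then show "u \<Gamma>' (restr W e w) = restr P e (u \<Gamma> w)" by simp
    qed
    show ?thesis
    proof (rule ex1I[of _ u])
      show "u \<in> psh_hom CC W P \<and> psh_comp CC W u h = a \<and> psh_comp CC W u k = b"
        using u_hom psh_comp_eqI[OF a, of h u] psh_comp_eqI[OF b, of k u] u(2,3) by blast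
    next
      fix v assume v: "v \<in> psh_hom CC W P \<and> psh_comp CC W v h = a \<and> psh_comp CC W v k = b"
      show "v = u"
      proof (rule psh_hom_eqI[OF conjunct1[OF v] u_hom])
        fix \<Gamma> w assume "\<Gamma> \<in> Ob CC" "w \<in> val W \<Gamma>"
        then show "v \<Gamma> w = u \<Gamma> w"
          using uniq[of \<Gamma> w "v \<Gamma> w"] v psh_hom_val[of v CC W P \<Gamma> w]
            psh_comp_apply[of \<Gamma> CC w W v h] psh_comp_apply[of \<Gamma> CC w W v k] by auto
      qed
    qed
  qed
  moreover have "psh_comp CC P h f = psh_comp CC P k g"
    using pw unfolding pointwise_pullback_def psh_comp_eq_iff by blast
  ultimately show ?thesis using P A B C h k f g unfolding psh_pullback_def by auto
qed

lemma psh_pullback_iff_pointwise: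
  assumes "is_presheaf CC P" "is_presheaf CC A" "is_presheaf CC B" "is_presheaf CC C"
    and "h \<in> psh_hom CC P A" "k \<in> psh_hom CC P B" "f \<in> psh_hom CC A C" "g \<in> psh_hom CC B C"
  shows "psh_pullback TYPE('m + 'u) CC P A B C h k f g \<longleftrightarrow> pointwise_pullback CC P A B h k f g"
  using pointwise_pullback_if_psh_pullback psh_pullback_if_pointwise_pullback[OF assms] by blast

end

section \<open>The presheaves of types\<close>

context c_system
begin

lemma pb_commute:
  assumes "X \<in> Ob CC" "len CC X > 0" "f \<in> Hom CC Y (ft CC X)"
  shows "proj CC (pb CC f X) \<cdot> f = qm CC f X \<cdot> proj CC X"
  using pb_square[OF assms] unfolding is_pullback_def by blast

lemma pb_universal:
  assumes X: "X \<in> Ob CC" "len CC X > 0" "f \<in> Hom CC Y (ft CC X)"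
    and a: "a \<in> Hom CC W Y" and b: "b \<in> Hom CC W X" and eq: "a \<cdot> f = b \<cdot> proj CC X"
  shows "\<exists>!u. u \<in> Hom CC W (pb CC f X) \<and> u \<cdot> proj CC (pb CC f X) = a \<and> u \<cdot> qm CC f X = b"
proof -
  obtain P A B C where pb: "proj CC (pb CC f X) \<in> Hom CC P A" "qm CC f X \<in> Hom CC P B"
      "f \<in> Hom CC A C" "proj CC X \<in> Hom CC B C"
    and univ: "\<forall>W \<in> Ob CC. \<forall>a \<in> Hom CC W A. \<forall>b \<in> Hom CC W B. a \<cdot> f = b \<cdot> proj CC X \<longrightarrow>
           (\<exists>!u. u \<in> Hom CC W P \<and> u \<cdot> proj CC (pb CC f X) = a \<and> u \<cdot> qm CC f X = b)"
    using pb_square[OF X] unfolding is_pullback_def by blast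
  have "P = pb CC f X" "A = Y" "B = X"
    using pb q_Hom[OF X] X(3) unfolding Hom_def by auto
  then show ?thesis using univ a b eq Hom_Ob(1)[OF a] by blast
qed

lemma Obn_Suc_iff:
  "X \<in> val (Obn CC (Suc n)) \<Gamma> \<longleftrightarrow> X \<in> Ob CC \<and> len CC X > 0 \<and> ft CC X \<in> val (Obn CC n) \<Gamma>"
  using ft_Ob len_ft by (auto simp: Obn_def funpow_swap1)

lemma Obn_Ob: "X \<in> val (Obn CC n) \<Gamma> \<Longrightarrow> X \<in> Ob CC"
  by (auto simp: Obn_def)

lemma Obn_base_Ob:
  assumes "X \<in> val (Obn CC n) \<Gamma>"
  shows "\<Gamma> \<in> Ob CC"
proof -
  have "(ft CC ^^ k) X \<in> Ob CC" for k
    using Obn_Ob[OF assms] by (induction k) (auto intro: ft_Ob)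
  then show ?thesis using assms by (auto simp: Obn_def)
qed

lemma Obn_over: "X \<in> val (Obn CC n) \<Gamma> \<Longrightarrow> over CC X \<Gamma>"
  using Obn_base_Ob[of X n \<Gamma>] by (auto simp: Obn_def over_def)

text \<open>The number of steps in the recursions for \<open>f\<^sup>*\<close> and \<open>p\<close> is the height of \<open>X\<close> over \<open>\<Gamma>\<close>.\<close>

lemma pull_height:
  assumes "X \<in> val (Obn CC n) \<Gamma>"
  shows "f \<in> Hom CC \<Gamma>' \<Gamma> \<Longrightarrow> pull_ob CC f X = pbn n CC f X"
    and "f \<in> Hom CC \<Gamma>' \<Gamma> \<Longrightarrow> pull_q CC f X = qn n CC f X"
    and "proj_to CC X \<Gamma> = projn n CC X"
  using assms by (auto simp: Obn_def Hom_def pull_ob_def pull_q_def proj_to_def)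

lemma pbn_qn_typing:
  assumes "X \<in> val (Obn CC n) \<Gamma>" "f \<in> Hom CC \<Gamma>' \<Gamma>"
  shows "pbn n CC f X \<in> val (Obn CC n) \<Gamma>' \<and> qn n CC f X \<in> Hom CC (pbn n CC f X) X"
  using assms
proof (induction n arbitrary: X)
  case 0
  then show ?case using Hom_Ob[of f] by (auto simp: Obn_def Hom_def)
next
  case (Suc n)
  then have X: "X \<in> Ob CC" "len CC X > 0" "ft CC X \<in> val (Obn CC n) \<Gamma>"
    by (auto simp: Obn_Suc_iff)
  note IH = Suc.IH[OF X(3) Suc.prems(2)]
  then have q: "qn n CC f (ft CC X) \<in> Hom CC (pbn n CC f (ft CC X)) (ft CC X)" by simp
  show ?case
    using pb_Ob[OF X(1,2) q] len_pb[OF X(1,2) q] ft_pb[OF X(1,2) q] q_Hom[OF X(1,2) q] IH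
    by (simp add: Obn_Suc_iff)
qed

lemmas pbn_Obn = pbn_qn_typing[THEN conjunct1]
lemmas qn_Hom = pbn_qn_typing[THEN conjunct2]

lemma ft_pbn_Suc:
  assumes X: "X \<in> val (Obn CC (Suc n)) \<Gamma>" and f: "f \<in> Hom CC \<Gamma>' \<Gamma>"
  shows "ft CC (pbn (Suc n) CC f X) = pbn n CC f (ft CC X)"
  using X ft_pb[OF _ _ qn_Hom[OF _ f]] by (auto simp: Obn_Suc_iff)

lemma pbn_qn_Id:
  assumes "X \<in> val (Obn CC n) \<Gamma>"
  shows "pbn n CC (Idm CC \<Gamma>) X = X \<and> qn n CC (Idm CC \<Gamma>) X = Idm CC X"
  using assms
proof (induction n arbitrary: X)
  case 0
  then show ?case using Id_Hom[of X] by (auto simp: Obn_def Hom_def)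
next
  case (Suc n)
  then show ?case by (simp add: Obn_Suc_iff pb_Id q_Id)
qed

lemma pbn_qn_cmp:
  assumes "X \<in> val (Obn CC n) \<Gamma>" "g \<in> Hom CC \<Gamma>'' \<Gamma>'" "f \<in> Hom CC \<Gamma>' \<Gamma>"
  shows "pbn n CC (g \<cdot> f) X = pbn n CC g (pbn n CC f X) \<and>
         qn n CC (g \<cdot> f) X = qn n CC g (pbn n CC f X) \<cdot> qn n CC f X"
  using assms
proof (induction n arbitrary: X)
  case 0
  then show ?case using cmp_Hom[of g] by (auto simp: Hom_def)
next
  case (Suc n)
  then have X: "X \<in> Ob CC" "len CC X > 0" "ft CC X \<in> val (Obn CC n) \<Gamma>"
    by (auto simp: Obn_Suc_iff)
  note g = Suc.prems(2) and f = Suc.prems(3)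
  note q = qn_Hom[OF X(3) f] qn_Hom[OF pbn_Obn[OF X(3) f] g]
  show ?case
    using Suc.IH[OF X(3) g f] pb_cmp[OF X(1,2) q(2,1)] q_cmp[OF X(1,2) q(2,1)]
      ft_pb[OF X(1,2) q(1)] by simp
qed

lemma is_presheaf_Obn: "is_presheaf CC (Obn CC n)"
proof -
  have restr: "restr (Obn CC n) f X = pbn n CC f X"
    if "X \<in> val (Obn CC n) \<Gamma>" "f \<in> Hom CC \<Gamma>' \<Gamma>" for X \<Gamma> \<Gamma>' f
    using pull_height(1)[OF that] by (simp add: Obn_def)
  have "restr (Obn CC n) (g \<cdot> f) X = restr (Obn CC n) g (restr (Obn CC n) f X)"
    if g: "g \<in> Hom CC \<Gamma>'' \<Gamma>'" and f: "f \<in> Hom CC \<Gamma>' \<Gamma>" and X: "X \<in> val (Obn CC n) \<Gamma>"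
    for \<Gamma>'' \<Gamma>' \<Gamma> g f X
    using restr[OF X f] restr[OF X cmp_Hom[OF g f]] restr[OF pbn_Obn[OF X f] g]
      pbn_qn_cmp[OF X g f] by simp
  moreover have "restr (Obn CC n) f X \<in> val (Obn CC n) \<Gamma>'"
    if "f \<in> Hom CC \<Gamma>' \<Gamma>" and "X \<in> val (Obn CC n) \<Gamma>" for \<Gamma>' \<Gamma> f X
    using restr[OF that(2,1)] pbn_Obn[OF that(2,1)] by simp
  moreover have "restr (Obn CC n) (Idm CC \<Gamma>) X = X"
    if "\<Gamma> \<in> Ob CC" and "X \<in> val (Obn CC n) \<Gamma>" for \<Gamma> X
    using restr[OF that(2) Id_Hom[OF that(1)]] pbn_qn_Id[OF that(2)] by simp
  ultimately show ?thesis unfolding is_presheaf_def by blast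
qed

section \<open>The presheaves of terms\<close>

lemma Obtn_Suc_iff:
  "s \<in> val (Obtn CC (Suc n)) \<Gamma> \<longleftrightarrow>
     tgt CC s \<in> val (Obn CC (Suc n)) \<Gamma> \<and> s \<in> Hom CC (ft CC (tgt CC s)) (tgt CC s) \<and>
     s \<cdot> proj CC (tgt CC s) = Idm CC (ft CC (tgt CC s))"
proof -
  have "src CC (proj CC X) = X \<and> tgt CC (proj CC X) = ft CC X" if "X \<in> Ob CC" for X
    using proj_Hom[OF that] by (simp add: Hom_def)
  moreover have "strictly_over CC X \<Gamma>" if "X \<in> val (Obn CC (Suc n)) \<Gamma>" for X
    using Obn_over[OF that] that by (simp add: strictly_over_def Obn_def)
  ultimately show ?thesis
    using Obn_Ob[of "tgt CC s" "Suc n" \<Gamma>] by (auto simp: Obtn_def sec_def Hom_def)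
qed

lemma Obtn_0: "val (Obtn CC 0) \<Gamma> = {}"
  by (auto simp: Obtn_def Obn_def strictly_over_def)

lemma Obtn_tgt: "s \<in> val (Obtn CC n) \<Gamma> \<Longrightarrow> tgt CC s \<in> val (Obn CC n) \<Gamma>"
  by (simp add: Obtn_def)

lemma projn_Hom: "X \<in> val (Obn CC n) \<Gamma> \<Longrightarrow> projn n CC X \<in> Hom CC X \<Gamma>"
proof (induction n arbitrary: X)
  case 0
  then show ?case using Id_Hom by (auto simp: Obn_def)
next
  case (Suc n)
  then show ?case using proj_Hom cmp_Hom by (fastforce simp: Obn_Suc_iff)
qed

text \<open>
  The uniqueness half of the fact that the iterated square with sides \<open>p(f\<^sup>*(X), \<Gamma>')\<close> and
  \<open>q(f, X)\<close> is again a pullback, obtained by stacking the canonical squares.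
\<close>

lemma projn_qn_jointly_monic:
  assumes "X \<in> val (Obn CC n) \<Gamma>" "f \<in> Hom CC \<Gamma>' \<Gamma>"
    and "u \<in> Hom CC W (pbn n CC f X)" "v \<in> Hom CC W (pbn n CC f X)"
    and "u \<cdot> projn n CC (pbn n CC f X) = v \<cdot> projn n CC (pbn n CC f X)"
    and "u \<cdot> qn n CC f X = v \<cdot> qn n CC f X"
  shows "u = v"
  using assms
proof (induction n arbitrary: X u v)
  case 0
  then show ?case by (simp add: cmp_Id)
next
  case (Suc n)
  then have X: "X \<in> Ob CC" "len CC X > 0" "ft CC X \<in> val (Obn CC n) \<Gamma>"
    by (auto simp: Obn_Suc_iff)
  note f = Suc.prems(2) and u = Suc.prems(3) and v = Suc.prems(4)
  let ?P = "pbn (Suc n) CC f X" and ?Y = "pbn n CC f (ft CC X)"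
  let ?q = "qn n CC f (ft CC X)"
  note q = qn_Hom[OF X(3) f] and Q = qn_Hom[OF Suc.prems(1) f]
  have P: "?P \<in> Ob CC" and ftP: "ft CC ?P = ?Y"
    using pbn_Obn[OF Suc.prems(1) f] ft_pbn_Suc[OF Suc.prems(1) f] Obn_Ob by auto
  have p: "proj CC ?P \<in> Hom CC ?P ?Y" using proj_Hom[OF P] ftP by simp
  note pn = projn_Hom[OF pbn_Obn[OF X(3) f]]
  have sq: "proj CC ?P \<cdot> ?q = qn (Suc n) CC f X \<cdot> proj CC X"
    using pb_commute[OF X(1,2) q] by simp
  have step: "(w \<cdot> proj CC ?P) \<cdot> projn n CC ?Y = w \<cdot> projn (Suc n) CC ?P"
      "(w \<cdot> proj CC ?P) \<cdot> ?q = (w \<cdot> qn (Suc n) CC f X) \<cdot> proj CC X"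
    if w: "w \<in> Hom CC W ?P" for w
    using cmp_assoc[OF w p pn] cmp_assoc[OF w p q] cmp_assoc[OF w Q proj_Hom[OF X(1)]] sq ftP
    by (simp_all del: pbn.simps qn.simps)
  have up: "u \<cdot> proj CC ?P = v \<cdot> proj CC ?P"
    using Suc.IH[OF X(3) f cmp_Hom[OF u p] cmp_Hom[OF v p]] step[OF u] step[OF v]
      Suc.prems(5,6) by (simp del: pbn.simps qn.simps projn.simps)
  have "\<exists>!w. w \<in> Hom CC W ?P \<and> w \<cdot> proj CC ?P = u \<cdot> proj CC ?P \<and>
      w \<cdot> qn (Suc n) CC f X = u \<cdot> qn (Suc n) CC f X"
    using pb_universal[OF X(1,2) q cmp_Hom[OF u p] cmp_Hom[OF u Q]] step(2)[OF u] by simp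
  then show ?case using u v up Suc.prems(6) by metis
qed

text \<open>
  The defining condition of \<open>f\<^sup>*(s)\<close> refers to the base \<open>\<Gamma>'\<close>, whereas the canonical square at the
  top of the tower only involves \<open>ft\<close>.  The two conditions agree for a section \<open>s\<close>: since
  \<open>s \<cdot> p\<close> is the identity, the composite of \<open>f\<^sup>*(s)\<close> with the pulled back projection has the same
  components in \<open>\<Gamma>'\<close> and in \<open>ft X\<close> as the identity.
\<close>

lemma pull_mor_eq_iff:
  assumes s: "s \<in> val (Obtn CC (Suc n)) \<Gamma>" and f: "f \<in> Hom CC \<Gamma>' \<Gamma>"
  defines "P \<equiv> pbn (Suc n) CC f (tgt CC s)" and "Y \<equiv> pbn n CC f (ft CC (tgt CC s))"
  shows "pull_mor CC f s = b \<longleftrightarrow>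
     b \<in> Hom CC Y P \<and> b \<cdot> proj CC P = Idm CC Y \<and>
     b \<cdot> qn (Suc n) CC f (tgt CC s) = qn n CC f (ft CC (tgt CC s)) \<cdot> s"
proof -
  define X where "X = tgt CC s"
  have XO: "X \<in> val (Obn CC (Suc n)) \<Gamma>" and sH: "s \<in> Hom CC (ft CC X) X"
    and sec: "s \<cdot> proj CC X = Idm CC (ft CC X)" and src: "src CC s = ft CC X"
    using s by (auto simp: Obtn_Suc_iff X_def Hom_def)
  then have X: "X \<in> Ob CC" "len CC X > 0" "ft CC X \<in> val (Obn CC n) \<Gamma>"
    by (auto simp: Obn_Suc_iff)
  let ?q = "qn n CC f (ft CC X)" and ?Q = "qn (Suc n) CC f X"
  have P: "P \<in> val (Obn CC (Suc n)) \<Gamma>'" and Y: "Y \<in> val (Obn CC n) \<Gamma>'" and ftP: "ft CC P = Y"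
    and q: "?q \<in> Hom CC Y (ft CC X)" and Q: "?Q \<in> Hom CC P X"
    using pbn_Obn[OF XO f] pbn_Obn[OF X(3) f] ft_pbn_Suc[OF XO f] qn_Hom[OF X(3) f]
      qn_Hom[OF XO f] by (auto simp: P_def Y_def X_def)
  have p: "proj CC P \<in> Hom CC P Y" using proj_Hom[OF Obn_Ob[OF P]] ftP by simp
  have sq: "proj CC P \<cdot> ?q = ?Q \<cdot> proj CC X"
    using pb_commute[OF X(1,2) q] by (simp add: P_def X_def)
  have qs: "(?q \<cdot> s) \<cdot> proj CC X = ?q"
    using cmp_assoc[OF q sH proj_Hom[OF X(1)]] sec cmp_Id[OF q] by simp
  have IdY: "Idm CC Y \<in> Hom CC Y Y" using Id_Hom Obn_Ob[OF Y] by blast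
  have cond: "mor_over CC \<Gamma>' b \<longleftrightarrow> b \<cdot> proj CC P = Idm CC Y"
    if b: "b \<in> Hom CC Y P" and bQ: "b \<cdot> ?Q = ?q \<cdot> s" for b
  proof -
    have "mor_over CC \<Gamma>' b \<longleftrightarrow> b \<cdot> projn (Suc n) CC P = projn n CC Y"
      using b pull_height(3)[OF P] pull_height(3)[OF Y] Obn_over[OF P] Obn_over[OF Y]
      by (auto simp: mor_over_def Hom_def)
    also have "\<dots> \<longleftrightarrow> (b \<cdot> proj CC P) \<cdot> projn n CC Y = Idm CC Y \<cdot> projn n CC Y"
      using cmp_assoc[OF b p projn_Hom[OF Y]] Id_cmp[OF projn_Hom[OF Y]] ftP by simp
    also have "\<dots> \<longleftrightarrow> b \<cdot> proj CC P = Idm CC Y"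
    proof -
      have "(b \<cdot> proj CC P) \<cdot> ?q = Idm CC Y \<cdot> ?q"
        using cmp_assoc[OF b p q] cmp_assoc[OF b Q proj_Hom[OF X(1)]] sq bQ qs Id_cmp[OF q]
        by simp
      then show ?thesis
        using projn_qn_jointly_monic[OF X(3) f, of "b \<cdot> proj CC P" Y "Idm CC Y"]
          cmp_Hom[OF b p] IdY by (auto simp: Y_def X_def)
    qed
    finally show ?thesis .
  qed
  have ex1: "\<exists>!b. b \<in> Hom CC Y P \<and> b \<cdot> proj CC P = Idm CC Y \<and> b \<cdot> ?Q = ?q \<cdot> s"
    using pb_universal[OF X(1,2) q IdY cmp_Hom[OF q sH]] qs Id_cmp[OF q]
    by (simp add: P_def X_def)
  have "src CC f = \<Gamma>'" using f by (simp add: Hom_def)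
  then have "pull_mor CC f s =
      (THE b. b \<in> Hom CC Y P \<and> mor_over CC \<Gamma>' b \<and> b \<cdot> ?Q = ?q \<cdot> s)"
    using pull_height(1,2)[OF XO f] pull_height(1,2)[OF X(3) f] src
    by (simp add: pull_mor_def P_def Y_def X_def del: pbn.simps qn.simps)
  also have "\<dots> = (THE b. b \<in> Hom CC Y P \<and> b \<cdot> proj CC P = Idm CC Y \<and> b \<cdot> ?Q = ?q \<cdot> s)"
    using cond by (intro arg_cong[where f = The]) (auto simp: fun_eq_iff)
  finally show ?thesis
    using the1_equality[OF ex1, of b] theI'[OF ex1] unfolding X_def by auto
qed

lemma pull_mor_section:
  assumes s: "s \<in> val (Obtn CC (Suc n)) \<Gamma>" and f: "f \<in> Hom CC \<Gamma>' \<Gamma>"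
  shows "pull_mor CC f s \<in>
      Hom CC (pbn n CC f (ft CC (tgt CC s))) (pbn (Suc n) CC f (tgt CC s))"
    and "pull_mor CC f s \<cdot> proj CC (pbn (Suc n) CC f (tgt CC s)) =
      Idm CC (pbn n CC f (ft CC (tgt CC s)))"
    and "pull_mor CC f s \<cdot> qn (Suc n) CC f (tgt CC s) = qn n CC f (ft CC (tgt CC s)) \<cdot> s"
  using pull_mor_eq_iff[OF s f, of "pull_mor CC f s"] by auto

lemma tgt_pull_mor:
  assumes "s \<in> val (Obtn CC (Suc n)) \<Gamma>" "f \<in> Hom CC \<Gamma>' \<Gamma>"
  shows "tgt CC (pull_mor CC f s) = pbn (Suc n) CC f (tgt CC s)"
  using pull_mor_section(1)[OF assms] by (simp add: Hom_def)

lemma pull_mor_Obtn: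
  assumes s: "s \<in> val (Obtn CC (Suc n)) \<Gamma>" and f: "f \<in> Hom CC \<Gamma>' \<Gamma>"
  shows "pull_mor CC f s \<in> val (Obtn CC (Suc n)) \<Gamma>'"
  using pull_mor_section[OF s f] tgt_pull_mor[OF s f] pbn_Obn[OF Obtn_tgt[OF s] f]
    ft_pbn_Suc[OF Obtn_tgt[OF s] f]
  by (simp add: Obtn_Suc_iff del: pbn.simps)

lemma pull_mor_Id:
  assumes s: "s \<in> val (Obtn CC (Suc n)) \<Gamma>"
  shows "pull_mor CC (Idm CC \<Gamma>) s = s"
proof -
  let ?X = "tgt CC s"
  have X: "?X \<in> val (Obn CC (Suc n)) \<Gamma>" "ft CC ?X \<in> val (Obn CC n) \<Gamma>"
    and sH: "s \<in> Hom CC (ft CC ?X) ?X"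
    using s by (auto simp: Obtn_Suc_iff Obn_Suc_iff)
  show ?thesis
    using s pbn_qn_Id[OF X(1)] pbn_qn_Id[OF X(2)] cmp_Id[OF sH] Id_cmp[OF sH]
      pull_mor_eq_iff[OF s Id_Hom[OF Obn_base_Ob[OF X(1)]], of s]
    by (simp add: Obtn_Suc_iff del: pbn.simps qn.simps)
qed

lemma pull_mor_cmp:
  assumes s: "s \<in> val (Obtn CC (Suc n)) \<Gamma>" and g: "g \<in> Hom CC \<Gamma>'' \<Gamma>'" and f: "f \<in> Hom CC \<Gamma>' \<Gamma>"
  shows "pull_mor CC (g \<cdot> f) s = pull_mor CC g (pull_mor CC f s)"
proof -
  let ?X = "tgt CC s" and ?b = "pull_mor CC f s"
  let ?c = "pull_mor CC g ?b"
  have X: "?X \<in> val (Obn CC (Suc n)) \<Gamma>" "ft CC ?X \<in> val (Obn CC n) \<Gamma>"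
    and sH: "s \<in> Hom CC (ft CC ?X) ?X"
    using s by (auto simp: Obtn_Suc_iff Obn_Suc_iff)
  let ?fX = "pbn (Suc n) CC f ?X" and ?fY = "pbn n CC f (ft CC ?X)"
  note b = pull_mor_section[OF s f]
  have c: "?c \<in> Hom CC (pbn n CC g ?fY) (pbn (Suc n) CC g ?fX)"
      "?c \<cdot> proj CC (pbn (Suc n) CC g ?fX) = Idm CC (pbn n CC g ?fY)"
      "?c \<cdot> qn (Suc n) CC g ?fX = qn n CC g ?fY \<cdot> ?b"
    using pull_mor_section[OF pull_mor_Obtn[OF s f] g] tgt_pull_mor[OF s f] ft_pbn_Suc[OF X(1) f]
    by (simp_all del: pbn.simps qn.simps)
  note gfX = pbn_qn_cmp[OF X(1) g f] and gfY = pbn_qn_cmp[OF X(2) g f]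
  note Qf = qn_Hom[OF X(1) f] and Qg = qn_Hom[OF pbn_Obn[OF X(1) f] g]
  note qf = qn_Hom[OF X(2) f] and qg = qn_Hom[OF pbn_Obn[OF X(2) f] g]
  have "?c \<cdot> (qn (Suc n) CC g ?fX \<cdot> qn (Suc n) CC f ?X) =
      (qn n CC g ?fY \<cdot> qn n CC f (ft CC ?X)) \<cdot> s"
    using cmp_assoc[OF c(1) Qg Qf] c(3) cmp_assoc[OF qg b(1) Qf] b(3) cmp_assoc[OF qg qf sH]
    by (simp del: pbn.simps qn.simps)
  then show ?thesis
    using pull_mor_eq_iff[OF s cmp_Hom[OF g f], of ?c] c(1,2) gfX gfY
    by (simp del: pbn.simps qn.simps)
qed

lemma restr_Obtn: "restr (Obtn CC n) = pull_mor CC"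
  by (simp add: Obtn_def)

lemma is_presheaf_Obtn: "is_presheaf CC (Obtn CC n)"
proof (cases n)
  case 0
  then show ?thesis by (simp add: is_presheaf_def Obtn_0)
next
  case (Suc m)
  then show ?thesis
    using pull_mor_Obtn[of _ m] pull_mor_Id[of _ m] pull_mor_cmp[of _ m]
    unfolding is_presheaf_def restr_Obtn by blast
qed

lemma bd_eq: "s \<in> val (Obtn CC n) \<Gamma> \<Longrightarrow> bd CC n \<Gamma> s = tgt CC s"
  using Obn_base_Ob[OF Obtn_tgt] by (simp add: bd_def)

lemma bd_psh_hom: "bd CC n \<in> psh_hom CC (Obtn CC n) (Obn CC n)"
proof (rule psh_homI)
  fix \<Gamma> assume "\<Gamma> \<in> Ob CC"
  then show "bd CC n \<Gamma> \<in> val (Obtn CC n) \<Gamma> \<rightarrow>\<^sub>E val (Obn CC n) \<Gamma>"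
    using Obtn_tgt by (auto simp: bd_def)
next
  fix \<Gamma> assume "\<Gamma> \<notin> Ob CC"
  then show "bd CC n \<Gamma> = undefined" by (simp add: bd_def)
next
  fix \<Gamma>' \<Gamma> f s
  assume f: "f \<in> Hom CC \<Gamma>' \<Gamma>" and s: "s \<in> val (Obtn CC n) \<Gamma>"
  then obtain m where m: "n = Suc m" by (cases n) (auto simp: Obtn_0)
  have "tgt CC (pull_mor CC f s) = pull_ob CC f (tgt CC s)"
    using tgt_pull_mor[of s m \<Gamma> f \<Gamma>'] pull_height(1)[OF Obtn_tgt[OF s] f] s f m by simp
  moreover have "restr (Obn CC n) = pull_ob CC" by (simp add: Obn_def)
  ultimately show "bd CC n \<Gamma>' (restr (Obtn CC n) f s) = restr (Obn CC n) f (bd CC n \<Gamma> s)"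
    using bd_eq[OF s] bd_eq[OF presheaf_restr_val[OF is_presheaf_Obtn f s]] restr_Obtn by simp
qed

section \<open>Pullback structures and families of fiber bijections\<close>

lemma bd_fiber_iff: "s \<in> bd_fiber CC n \<Gamma> B \<longleftrightarrow> s \<in> val (Obtn CC n) \<Gamma> \<and> tgt CC s = B"
  using bd_eq by (auto simp: bd_fiber_def)

lemma lambda_1_to_2_apply:
  "B \<in> val (Obn CC 2) \<Gamma> \<Longrightarrow> s \<in> bd_fiber CC 2 \<Gamma> B \<Longrightarrow> lambda_1_to_2 CC lam \<Gamma> B s = lam \<Gamma> s"
  using Obn_base_Ob by (simp add: lambda_1_to_2_def)

lemma lambda_2_to_1_apply:
  "s \<in> val (Obtn CC 2) \<Gamma> \<Longrightarrow> lambda_2_to_1 CC fam \<Gamma> s = fam \<Gamma> (tgt CC s) s"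
  using Obn_base_Ob[OF Obtn_tgt] bd_eq by (simp add: lambda_2_to_1_def)

context
  fixes PiS :: "'a \<Rightarrow> 'a \<Rightarrow> 'a"
  assumes PiS: "PiS \<in> psh_hom CC (Obn CC 2) (Obn CC 1)"
begin

text \<open>
  A compatible pair \<open>(t, B)\<close> is the same as a point \<open>t\<close> of the fiber over \<open>\<Pi>\<^sub>\<Gamma>(B)\<close>, and a solution
  for it is a preimage of \<open>t\<close> in the fiber over \<open>B\<close>.  Commutativity of the square says that
  \<open>\<lambda>\<^sub>\<Gamma>\<close> maps the one fiber into the other; unique solvability says that it does so bijectively.
\<close>

lemma pointwise_pullback_iff_fiber_bij:
  assumes lam: "lam \<in> psh_hom CC (Obtn CC 2) (Obtn CC 1)"
  shows "pointwise_pullback CC (Obtn CC 2) (Obtn CC 1) (Obn CC 2) lam (bd CC 2) (bd CC 1) PiS \<longleftrightarrow>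
    (\<forall>\<Gamma> \<in> Ob CC. \<forall>B \<in> val (Obn CC 2) \<Gamma>.
       bij_betw (lam \<Gamma>) (bd_fiber CC 2 \<Gamma> B) (bd_fiber CC 1 \<Gamma> (PiS \<Gamma> B)))"
    (is "?pw \<longleftrightarrow> ?bij")
proof
  assume ?pw
  then have sq: "\<And>\<Gamma> s. s \<in> val (Obtn CC 2) \<Gamma> \<Longrightarrow> tgt CC (lam \<Gamma> s) = PiS \<Gamma> (tgt CC s)"
    and ex1: "\<And>\<Gamma> t B. t \<in> val (Obtn CC 1) \<Gamma> \<Longrightarrow> B \<in> val (Obn CC 2) \<Gamma> \<Longrightarrow> tgt CC t = PiS \<Gamma> B \<Longrightarrow>
      \<exists>!s. s \<in> val (Obtn CC 2) \<Gamma> \<and> lam \<Gamma> s = t \<and> bd CC 2 \<Gamma> s = B"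
    unfolding pointwise_pullback_def
    using Obn_base_Ob Obtn_tgt bd_eq psh_hom_val[OF lam] by metis+
  show ?bij
  proof (intro ballI)
    fix \<Gamma> B assume \<Gamma>: "\<Gamma> \<in> Ob CC" and B: "B \<in> val (Obn CC 2) \<Gamma>"
    have into: "lam \<Gamma> s \<in> bd_fiber CC 1 \<Gamma> (PiS \<Gamma> B)" if "s \<in> bd_fiber CC 2 \<Gamma> B" for s
      using that sq psh_hom_val[OF lam \<Gamma>] by (auto simp: bd_fiber_iff)
    have uniq: "\<exists>!s. s \<in> bd_fiber CC 2 \<Gamma> B \<and> lam \<Gamma> s = t"
      if "t \<in> bd_fiber CC 1 \<Gamma> (PiS \<Gamma> B)" for t
      using ex1[OF _ B, of t] that bd_eq[of _ 2 \<Gamma>] unfolding bd_fiber_iff by metis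
    show "bij_betw (lam \<Gamma>) (bd_fiber CC 2 \<Gamma> B) (bd_fiber CC 1 \<Gamma> (PiS \<Gamma> B))"
      unfolding bij_betw_def inj_on_def using into uniq by (auto simp: image_iff) metis+
  qed
next
  assume bij: ?bij
  have "tgt CC (lam \<Gamma> s) = PiS \<Gamma> (tgt CC s)" if "s \<in> val (Obtn CC 2) \<Gamma>" for \<Gamma> s
  proof -
    have "s \<in> bd_fiber CC 2 \<Gamma> (tgt CC s)" using that by (simp add: bd_fiber_iff)
    then have "lam \<Gamma> s \<in> bd_fiber CC 1 \<Gamma> (PiS \<Gamma> (tgt CC s))"
      using bij Obtn_tgt[OF that] Obn_base_Ob bij_betwE by fast
    then show ?thesis by (simp add: bd_fiber_iff)
  qed
  moreover have "\<exists>!s. s \<in> val (Obtn CC 2) \<Gamma> \<and> lam \<Gamma> s = t \<and> bd CC 2 \<Gamma> s = B"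
    if \<Gamma>: "\<Gamma> \<in> Ob CC" and t: "t \<in> val (Obtn CC 1) \<Gamma>" and B: "B \<in> val (Obn CC 2) \<Gamma>"
      and tB: "bd CC 1 \<Gamma> t = PiS \<Gamma> B" for \<Gamma> t B
  proof -
    have tF: "t \<in> bd_fiber CC 1 \<Gamma> (PiS \<Gamma> B)" using t tB by (simp add: bd_fiber_def)
    have b: "bij_betw (lam \<Gamma>) (bd_fiber CC 2 \<Gamma> B) (bd_fiber CC 1 \<Gamma> (PiS \<Gamma> B))"
      using bij \<Gamma> B by blast
    from tF have "t \<in> lam \<Gamma> ` bd_fiber CC 2 \<Gamma> B"
      by (simp only: bij_betw_imp_surj_on[OF b])
    then obtain s where s: "s \<in> bd_fiber CC 2 \<Gamma> B" "t = lam \<Gamma> s" by (rule imageE)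
    have "\<exists>!s. s \<in> bd_fiber CC 2 \<Gamma> B \<and> lam \<Gamma> s = t"
    proof (rule ex1I[of _ s])
      fix s' assume "s' \<in> bd_fiber CC 2 \<Gamma> B \<and> lam \<Gamma> s' = t"
      then show "s' = s" using s inj_onD[OF bij_betw_imp_inj_on[OF b], of s' s] by simp
    qed (use s in simp)
    then show ?thesis by (auto simp: bd_fiber_def)
  qed
  ultimately show ?pw
    using bd_eq[of _ 2] bd_eq[OF psh_hom_val[OF lam]] unfolding pointwise_pullback_def by simp
qed

lemma All_lambda1_iff:
  "lam \<in> All_lambda1 TYPE('b + 'u) CC PiS \<longleftrightarrow>
     lam \<in> psh_hom CC (Obtn CC 2) (Obtn CC 1) \<and>
     (\<forall>\<Gamma> \<in> Ob CC. \<forall>B \<in> val (Obn CC 2) \<Gamma>.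
        bij_betw (lam \<Gamma>) (bd_fiber CC 2 \<Gamma> B) (bd_fiber CC 1 \<Gamma> (PiS \<Gamma> B)))"
  unfolding All_lambda1_def
  using psh_pullback_iff_pointwise[OF is_presheaf_Obtn is_presheaf_Obtn is_presheaf_Obn
      is_presheaf_Obn _ bd_psh_hom bd_psh_hom PiS] pointwise_pullback_iff_fiber_bij
  by blast

lemma restr_bd_fiber:
  assumes "f \<in> Hom CC \<Gamma>' \<Gamma>" "s \<in> bd_fiber CC n \<Gamma> B"
  shows "restr (Obtn CC n) f s \<in> bd_fiber CC n \<Gamma>' (restr (Obn CC n) f B)"
  using assms presheaf_restr_val[OF is_presheaf_Obtn assms(1)] psh_hom_natural[OF bd_psh_hom assms(1)]
  by (auto simp: bd_fiber_def)

lemma lambda_1_to_2_mem: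
  assumes "lam \<in> All_lambda1 TYPE('b + 'u) CC PiS"
  shows "lambda_1_to_2 CC lam \<in> All_lambda2 CC PiS"
proof -
  have lam: "lam \<in> psh_hom CC (Obtn CC 2) (Obtn CC 1)"
    and bij: "\<And>\<Gamma> B. \<Gamma> \<in> Ob CC \<Longrightarrow> B \<in> val (Obn CC 2) \<Gamma> \<Longrightarrow>
      bij_betw (lam \<Gamma>) (bd_fiber CC 2 \<Gamma> B) (bd_fiber CC 1 \<Gamma> (PiS \<Gamma> B))"
    using assms by (auto simp: All_lambda1_iff)
  let ?fam = "lambda_1_to_2 CC lam"
  have bij': "bij_betw (?fam \<Gamma> B) (bd_fiber CC 2 \<Gamma> B) (bd_fiber CC 1 \<Gamma> (PiS \<Gamma> B))"
    if "\<Gamma> \<in> Ob CC" "B \<in> val (Obn CC 2) \<Gamma>" for \<Gamma> B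
    using bij[OF that] lambda_1_to_2_apply[OF that(2)] by (simp cong: bij_betw_cong)
  moreover have "?fam \<in> (\<Pi>\<^sub>E \<Gamma> \<in> Ob CC. \<Pi>\<^sub>E B \<in> val (Obn CC 2) \<Gamma>.
              bd_fiber CC 2 \<Gamma> B \<rightarrow>\<^sub>E bd_fiber CC 1 \<Gamma> (PiS \<Gamma> B))"
    using bij[THEN bij_betwE] by (auto simp: lambda_1_to_2_def)
  moreover have "restr (Obtn CC 1) f (?fam \<Gamma> B s) =
      ?fam \<Gamma>' (restr (Obn CC 2) f B) (restr (Obtn CC 2) f s)"
    if f: "f \<in> Hom CC \<Gamma>' \<Gamma>" and B: "B \<in> val (Obn CC 2) \<Gamma>" and s: "s \<in> bd_fiber CC 2 \<Gamma> B"
    for \<Gamma>' \<Gamma> f B s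
    using lambda_1_to_2_apply[OF B s] psh_hom_natural[OF lam f, of s] s
      lambda_1_to_2_apply[OF presheaf_restr_val[OF is_presheaf_Obn f B] restr_bd_fiber[OF f s]]
    by (simp add: bd_fiber_def)
  ultimately show ?thesis unfolding All_lambda2_def by blast
qed

lemma lambda_2_to_1_mem:
  assumes "fam \<in> All_lambda2 CC PiS"
  shows "lambda_2_to_1 CC fam \<in> All_lambda1 TYPE('b + 'u) CC PiS"
proof -
  have bij: "\<And>\<Gamma> B. \<Gamma> \<in> Ob CC \<Longrightarrow> B \<in> val (Obn CC 2) \<Gamma> \<Longrightarrow>
      bij_betw (fam \<Gamma> B) (bd_fiber CC 2 \<Gamma> B) (bd_fiber CC 1 \<Gamma> (PiS \<Gamma> B))"
    and nat: "\<And>\<Gamma>' \<Gamma> f B s. f \<in> Hom CC \<Gamma>' \<Gamma> \<Longrightarrow> B \<in> val (Obn CC 2) \<Gamma> \<Longrightarrow>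
      s \<in> bd_fiber CC 2 \<Gamma> B \<Longrightarrow> restr (Obtn CC 1) f (fam \<Gamma> B s) =
              fam \<Gamma>' (restr (Obn CC 2) f B) (restr (Obtn CC 2) f s)"
    using assms unfolding All_lambda2_def by auto
  let ?lam = "lambda_2_to_1 CC fam"
  have own: "s \<in> bd_fiber CC 2 \<Gamma> (tgt CC s)" if "s \<in> val (Obtn CC 2) \<Gamma>" for s \<Gamma>
    using that by (simp add: bd_fiber_iff)
  have "?lam \<in> psh_hom CC (Obtn CC 2) (Obtn CC 1)"
  proof (rule psh_homI)
    fix \<Gamma> assume \<Gamma>: "\<Gamma> \<in> Ob CC"
    have "?lam \<Gamma> s \<in> val (Obtn CC 1) \<Gamma>" if s: "s \<in> val (Obtn CC 2) \<Gamma>" for s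
      using bij_betwE[OF bij[OF \<Gamma> Obtn_tgt[OF s]]] own[OF s] lambda_2_to_1_apply[OF s]
      by (simp add: bd_fiber_iff)
    then show "?lam \<Gamma> \<in> val (Obtn CC 2) \<Gamma> \<rightarrow>\<^sub>E val (Obtn CC 1) \<Gamma>"
      using \<Gamma> by (auto simp: lambda_2_to_1_def)
  next
    fix \<Gamma> assume "\<Gamma> \<notin> Ob CC"
    then show "?lam \<Gamma> = undefined" by (simp add: lambda_2_to_1_def)
  next
    fix \<Gamma>' \<Gamma> f s
    assume f: "f \<in> Hom CC \<Gamma>' \<Gamma>" and s: "s \<in> val (Obtn CC 2) \<Gamma>"
    show "?lam \<Gamma>' (restr (Obtn CC 2) f s) = restr (Obtn CC 1) f (?lam \<Gamma> s)"
      using nat[OF f Obtn_tgt[OF s] own[OF s]] restr_bd_fiber[OF f own[OF s]]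
        lambda_2_to_1_apply[OF s] lambda_2_to_1_apply[of "restr (Obtn CC 2) f s" \<Gamma>' fam]
      by (simp add: bd_fiber_iff)
  qed
  moreover have "bij_betw (?lam \<Gamma>) (bd_fiber CC 2 \<Gamma> B) (bd_fiber CC 1 \<Gamma> (PiS \<Gamma> B))"
    if "\<Gamma> \<in> Ob CC" "B \<in> val (Obn CC 2) \<Gamma>" for \<Gamma> B
  proof -
    have "?lam \<Gamma> s = fam \<Gamma> B s" if "s \<in> bd_fiber CC 2 \<Gamma> B" for s
      using that lambda_2_to_1_apply[of s \<Gamma> fam] by (auto simp: bd_fiber_iff)
    then show ?thesis using bij[OF that] by (simp cong: bij_betw_cong)
  qed
  ultimately show ?thesis unfolding All_lambda1_iff by blast
qed

lemma lambda_2_to_1_to_2: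
  assumes "fam \<in> All_lambda2 CC PiS"
  shows "lambda_1_to_2 CC (lambda_2_to_1 CC fam) = fam"
proof (intro ext)
  fix \<Gamma> B s
  have fam: "fam \<in> (\<Pi>\<^sub>E \<Gamma> \<in> Ob CC. \<Pi>\<^sub>E B \<in> val (Obn CC 2) \<Gamma>.
              bd_fiber CC 2 \<Gamma> B \<rightarrow>\<^sub>E bd_fiber CC 1 \<Gamma> (PiS \<Gamma> B))"
    using assms unfolding All_lambda2_def by blast
  consider "\<Gamma> \<notin> Ob CC" | "\<Gamma> \<in> Ob CC" "B \<notin> val (Obn CC 2) \<Gamma>"
    | "\<Gamma> \<in> Ob CC" "B \<in> val (Obn CC 2) \<Gamma>" "s \<notin> bd_fiber CC 2 \<Gamma> B"
    | "\<Gamma> \<in> Ob CC" "B \<in> val (Obn CC 2) \<Gamma>" "s \<in> bd_fiber CC 2 \<Gamma> B" by blast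
  then show "lambda_1_to_2 CC (lambda_2_to_1 CC fam) \<Gamma> B s = fam \<Gamma> B s"
  proof cases
    case 4
    then show ?thesis
      using lambda_1_to_2_apply lambda_2_to_1_apply by (auto simp: bd_fiber_iff)
  qed (use fam in \<open>auto simp: lambda_1_to_2_def PiE_iff extensional_def\<close>)
qed

lemma lambda_1_to_2_to_1:
  assumes "lam \<in> All_lambda1 TYPE('b + 'u) CC PiS"
  shows "lambda_2_to_1 CC (lambda_1_to_2 CC lam) = lam"
proof (rule psh_hom_eqI)
  show "lambda_2_to_1 CC (lambda_1_to_2 CC lam) \<in> psh_hom CC (Obtn CC 2) (Obtn CC 1)"
    using lambda_2_to_1_mem[OF lambda_1_to_2_mem[OF assms]] by (simp add: All_lambda1_iff)
  show "lam \<in> psh_hom CC (Obtn CC 2) (Obtn CC 1)"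
    using assms by (simp add: All_lambda1_iff)
next
  fix \<Gamma> s assume s: "s \<in> val (Obtn CC 2) \<Gamma>"
  show "lambda_2_to_1 CC (lambda_1_to_2 CC lam) \<Gamma> s = lam \<Gamma> s"
    using lambda_2_to_1_apply[OF s] lambda_1_to_2_apply[OF Obtn_tgt[OF s]] s
    by (simp add: bd_fiber_iff)
qed

end

end

theorem mainTheorem5:
  fixes CC :: "('o, 'm) csys"
    and PiS :: "'o \<Rightarrow> 'o \<Rightarrow> 'o"
  assumes "c_system CC"
    and "PiS \<in> psh_hom CC (Obn CC 2) (Obn CC 1)"
  shows "bij_betw (lambda_1_to_2 CC) (All_lambda1 TYPE('m + 'u) CC PiS) (All_lambda2 CC PiS) \<and>
         lambda_2_to_1 CC \<in> All_lambda2 CC PiS \<rightarrow> All_lambda1 TYPE('m + 'u) CC PiS \<and>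
         (\<forall>lam \<in> All_lambda1 TYPE('m + 'u) CC PiS. lambda_2_to_1 CC (lambda_1_to_2 CC lam) = lam) \<and>
         (\<forall>fam \<in> All_lambda2 CC PiS. lambda_1_to_2 CC (lambda_2_to_1 CC fam) = fam)"
proof -
  interpret c_system CC by fact
  note PiS = assms(2)
  have to2: "lambda_1_to_2 CC \<in> All_lambda1 TYPE('m + 'u) CC PiS \<rightarrow> All_lambda2 CC PiS"
    using lambda_1_to_2_mem[OF PiS] by blast
  have to1: "lambda_2_to_1 CC \<in> All_lambda2 CC PiS \<rightarrow> All_lambda1 TYPE('m + 'u) CC PiS"
    using lambda_2_to_1_mem[OF PiS] by blast
  have "bij_betw (lambda_1_to_2 CC) (All_lambda1 TYPE('m + 'u) CC PiS) (All_lambda2 CC PiS)"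
    by (rule bij_betwI[OF to2 to1])
      (auto intro: lambda_1_to_2_to_1[OF PiS] lambda_2_to_1_to_2[OF PiS])
  then show ?thesis
    using to1 lambda_1_to_2_to_1[OF PiS] lambda_2_to_1_to_2[OF PiS] by blast
qed

end
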